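(* Let $K\subset\mathcal{E}$ be a closed convex cone with nonempty interior and $K\ne\mathcal{E}$. Then, for $\lambda\in\mathbb{R}$, $K$ is inner $\lambda$-smoothable if and only if $\lambda\ge w_K$. In particular, for any target smoothness level $\beta>0$, a $\beta$-smooth closed convex set $S\subseteq\mathcal{E}$ is an optimal inner $\beta$-smoothing of $K$ if and only if $[s^{\mathrm{in}}_K]_{1/\beta}\subseteq S\subseteq[S^{\mathrm{in}}_K]_{1/\beta}$.
   Context: $\mathcal{E}$ is a finite-dimensional Euclidean space with inner product $\langle\cdot,\cdot\rangle$ and induced norm $\|\cdot\|$; $B(x,r)=\{y:\|x-y\|\le r\}$; sums of sets are Minkowski sums; all sets considered are nonempty. A convex cone is a set $K$ with $tx\in K$ for $x\in K$, $t\ge0$, and $x+y\in K$ for $x,y\in K$. For $\eta>0$, $[C]_\eta=\eta C=\{\eta x:x\in C\}$. Hausdorff distance: $\mathrm{dist}(x,C)=\inf_{y\in C}\|x-y\|$, $\mathrm{d}(\tilde C;C)=\sup_{x\in\tilde C}\mathrm{dist}(x,C)$, $\mathrm{dist}(\tilde C,C)=\max\{\mathrm{d}(\tilde C;C),\mathrm{d}(C;\tilde C)\}$ (possibly $+\infty$). Normal cone: $N_C(x)=\{\zeta:\langle\zeta,y-x\rangle\le0\ \forall y\in C\}$ for $x\in C$. A closed convex set $C$ is $\beta$-smooth if $\|\zeta-\zeta'\|\le\beta\|x-x'\|$ for all $x,x'\in C$ and all unit-norm $\zeta\in N_C(x)$, $\zeta'\in N_C(x')$. Inner smoothability: $K$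 is inner $\lambda$-smoothable if for every $\beta>0$ there is a $\beta$-smooth closed convex set $S\subseteq K$ with $\mathrm{dist}(S,K)\le\lambda/\beta$. A closed convex set $S$ is an optimal inner $\beta$-smoothing of $K$ if $S$ is $\beta$-smooth, $S\subseteq K$, and $\mathrm{dist}(K,S)\le\mathrm{dist}(K,\tilde S)$ for all $\beta$-smooth closed convex $\tilde S\subseteq K$. Core, center, width: $C_K=\{x\in\mathcal{E}:x+B(0,1)\subseteq K\}$; $x_K$ is the (unique) minimum-norm element of $C_K$; $w_K=\|x_K\|-1$. Extremal smoothings: $s^{\mathrm{in}}_K=(x_K+K)+B(0,1)$ and $S^{\mathrm{in}}_K=C_K+B(0,1)$. *)

theory Defs
  imports "HOL-Analysis.Analysis"
begin

definition excess :: "'a::metric_space set \<Rightarrow> 'a set \<Rightarrow> ereal"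
  where "excess C' C = (SUP x\<in>C'. ereal (infdist x C))"

text \<open>
  The Hausdorff distance takes values in the extended reals, as it may be infinite for unbounded
  sets. It is only meaningful for nonempty arguments (\<^const>\<open>infdist\<close> is 0 for an empty second
  argument); nonemptiness is built into \<open>smooth_set\<close> and \<^const>\<open>convex_cone\<close>.
\<close>

definition hausdorff_dist :: "'a::metric_space set \<Rightarrow> 'a set \<Rightarrow> ereal"
  where "hausdorff_dist C' C = max (excess C' C) (excess C C')"

definition normal_cone :: "'a::real_inner set \<Rightarrow> 'a \<Rightarrow> 'a set"
  where "normal_cone C x = {\<zeta>. \<forall>y\<in>C. \<zeta> \<bullet> (y - x) \<le> 0}"

definition smooth_set :: "real \<Rightarrow> 'a::real_inner set \<Rightarrow> bool"
  where "smooth_set \<beta> C \<longleftrightarrow> C \<noteq> {} \<and> closed C \<and> convex C \<and>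
    (\<forall>x\<in>C. \<forall>x'\<in>C. \<forall>\<zeta>\<in>normal_cone C x. \<forall>\<zeta>'\<in>normal_cone C x'.
       norm \<zeta> = 1 \<longrightarrow> norm \<zeta>' = 1 \<longrightarrow> norm (\<zeta> - \<zeta>') \<le> \<beta> * norm (x - x'))"

definition inner_smoothable :: "real \<Rightarrow> 'a::real_inner set \<Rightarrow> bool"
  where "inner_smoothable l K \<longleftrightarrow>
    (\<forall>\<beta>>0. \<exists>S. smooth_set \<beta> S \<and> S \<subseteq> K \<and> hausdorff_dist S K \<le> ereal (l / \<beta>))"

definition optimal_inner_smoothing :: "real \<Rightarrow> 'a::real_inner set \<Rightarrow> 'a set \<Rightarrow> bool"
  where "optimal_inner_smoothing \<beta> K S \<longleftrightarrow> smooth_set \<beta> S \<and> S \<subseteq> K \<and>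
    (\<forall>S'. smooth_set \<beta> S' \<and> S' \<subseteq> K \<longrightarrow> hausdorff_dist K S \<le> hausdorff_dist K S')"

definition cone_core :: "'a::real_normed_vector set \<Rightarrow> 'a set"
  where "cone_core K = {x. {x} + cball 0 1 \<subseteq> K}"

definition cone_center :: "'a::real_normed_vector set \<Rightarrow> 'a"
  where "cone_center K = (ARG_MIN norm x. x \<in> cone_core K)"

text \<open>The minimum-norm point exists and is unique in the case of interest.\<close>

lemma cone_core_min_norm_unique:
  fixes K :: "'a::euclidean_space set"
  assumes "convex_cone K" "closed K" "interior K \<noteq> {}"
  shows "\<exists>!x. is_arg_min norm (\<lambda>x. x \<in> cone_core K) x"
proof -
  have eq: "cone_core K = (\<Inter>b\<in>cball 0 1. (\<lambda>x. x - b) ` K)"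
    by (force simp: cone_core_def set_plus_def image_iff algebra_simps subset_iff)
  have cv: "convex K" using assms(1) by (simp add: convex_cone_def)
  have cl: "closed (cone_core K)" unfolding eq
    using closed_translation_subtract[OF assms(2)] by (intro closed_INT) auto
  have cx: "convex (cone_core K)" unfolding eq
    using convex_translation_subtract[OF cv] by (intro convex_INT) auto
  obtain a e where e: "e > 0" "cball a e \<subseteq> K"
    using assms(3) by (metis equals0I mem_interior_cball)
  have "(1 / e) *\<^sub>R a + b \<in> K" if "norm b \<le> 1" for b
  proof -
    have "a + e *\<^sub>R b \<in> K" using e that by (intro subsetD[OF e(2)]) (simp add: dist_norm)
    then have "(1 / e) *\<^sub>R (a + e *\<^sub>R b) \<in> K"
      using e(1) assms(1) by (intro convex_cone_scaleR) auto
    then show ?thesis using e(1) by (simp add: scaleR_right_distrib)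
  qed
  then have "(1 / e) *\<^sub>R a \<in> cone_core K" by (auto simp: cone_core_def set_plus_def)
  then have ne: "cone_core K \<noteq> {}" by auto
  show ?thesis
  proof (rule ex1I)
    show "is_arg_min norm (\<lambda>x. x \<in> cone_core K) (closest_point (cone_core K) 0)"
      using closest_point_exists[OF cl ne, of 0] by (auto simp: is_arg_min_def not_less)
  next
    fix x assume "is_arg_min norm (\<lambda>x. x \<in> cone_core K) x"
    then show "x = closest_point (cone_core K) 0"
      by (intro closest_point_unique[OF cx cl]) (auto simp: is_arg_min_def not_less)
  qed
qed

definition cone_width :: "'a::real_normed_vector set \<Rightarrow> real"
  where "cone_width K = norm (cone_center K) - 1"

definition min_inner_smoothing :: "'a::real_normed_vector set \<Rightarrow> 'a set"
  where "min_inner_smoothing K = ({cone_center K} + K) + cball 0 1"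

definition max_inner_smoothing :: "'a::real_normed_vector set \<Rightarrow> 'a set"
  where "max_inner_smoothing K = cone_core K + cball 0 1"

definition scaled_set :: "real \<Rightarrow> 'a::real_vector set \<Rightarrow> 'a set"
  where "scaled_set \<eta> C = (*\<^sub>R) \<eta> ` C"

end

theory Submission
  imports Defs
begin

text \<open>
  Write \<open>r = 1 / \<beta>\<close>. A closed convex set \<open>S\<close> is \<open>\<beta>\<close>-smooth exactly when it is a union of closed
  balls of radius \<open>r\<close> whose centers form a nonempty closed convex set. That such sums are smooth
  (\<open>smooth_set_plus_cball\<close>) is monotonicity of the normal cone. The converse carries the proof: a
  ball of radius \<open>r\<close> touches every boundary point of \<open>S\<close> from inside (\<open>smooth_set_inscribed_ball\<close>),
  and these balls, together with the ones around deep interior points, cover \<open>S\<close>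
  (\<open>smooth_set_covered_by_balls\<close>).

  Now let \<open>S \<subseteq> K\<close>. Each of these balls lies in \<open>K\<close>, so after scaling by \<open>\<beta>\<close> its center is in the
  core of \<open>K\<close>. This gives the upper inclusion, and it shows that no center has norm below
  \<open>r * norm x\<close>, where \<open>x\<close> is the center of \<open>K\<close>. Hence \<open>S\<close> misses the open ball of radius
  \<open>r * (norm x - 1)\<close> around the apex, and the Hausdorff distance to \<open>K\<close> is at least \<open>r\<close> times the
  width. The scaled minimal smoothing attains the bound, since the point \<open>k \<in> K\<close> is within that
  distance of the ball of radius \<open>r\<close> around \<open>r x + k\<close>. This settles smoothability and determines
  the optimal distance.

  If \<open>S\<close> attains the bound, then every point of \<open>K\<close> is within \<open>r * norm x\<close> of a ball center. At
  the apex, uniqueness of the minimum-norm element of the core forces \<open>r x\<close> itself to be a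
  center. Applying the bound to \<open>n k\<close> for all \<open>n\<close> shows that the closed convex set of centers
  recedes in the direction \<open>k\<close>. It therefore contains \<open>r x + k\<close> for all \<open>k \<in> K\<close>, which is the lower
  inclusion (\<open>near_smooth_set_contains_min_inner_smoothing\<close>).
\<close>

section \<open>Normals at nearest boundary points\<close>

lemma norm_diff_sq: "(norm (x - y))\<^sup>2 = (norm x)\<^sup>2 - 2 * (x \<bullet> y) + (norm y)\<^sup>2"
  using dot_norm_neg[of x y] by (simp add: field_simps)

lemma norm_add_sq: "(norm (x + y))\<^sup>2 = (norm x)\<^sup>2 + 2 * (x \<bullet> y) + (norm y)\<^sup>2"
  using dot_norm[of x y] by (simp add: field_simps)

lemma infdist_attained:
  fixes S :: "'a::euclidean_space set"
  assumes "closed S" and "S \<noteq> {}"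
  obtains s where "s \<in> S" and "infdist x S = dist x s"
  using that[OF closest_point_in_set[OF assms]] setdist_closest_point[OF assms]
  by (metis infdist_eq_setdist)

lemma scaled_normal_in_normal_cone:
  assumes "\<zeta> \<in> normal_cone S x" and "c \<ge> 0"
  shows "c *\<^sub>R \<zeta> \<in> normal_cone S x"
  using assms by (auto simp: normal_cone_def mult_nonneg_nonpos)

text \<open>
  The interior of \<open>S\<close> is separated from \<open>x\<close>; if it is empty, \<open>S\<close> lies in a hyperplane, whose normal
  serves.
\<close>

lemma boundary_unit_normal:
  fixes S :: "'a::euclidean_space set"
  assumes "closed S" and "convex S" and "x \<in> frontier S"
  obtains \<zeta> where "\<zeta> \<in> normal_cone S x" and "norm \<zeta> = 1"
proof -
  have x: "x \<in> S" "x \<notin> interior S"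
    using assms(1,3) by (auto simp: frontier_def)
  have "\<exists>a. a \<noteq> 0 \<and> (\<forall>y\<in>S. a \<bullet> y \<le> a \<bullet> x)"
  proof (cases "interior S = {}")
    case True
    then obtain a b where a: "a \<noteq> 0" "S \<subseteq> {y. a \<bullet> y = b}"
      using empty_interior_subset_hyperplane[OF assms(2)] by metis
    have "a \<bullet> y = a \<bullet> x" if "y \<in> S" for y
      using that x(1) a(2) by (metis (mono_tags) mem_Collect_eq subsetD)
    with a(1) show ?thesis by auto
  next
    case False
    have "convex ((\<lambda>y. y - x) ` interior S)" "0 \<notin> (\<lambda>y. y - x) ` interior S"
      using x assms(2) by (auto intro: convex_translation_subtract)
    from separating_hyperplane_set_0[OF this]
    obtain a where a: "a \<noteq> 0" "\<And>y. y \<in> interior S \<Longrightarrow> a \<bullet> x \<le> a \<bullet> y"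
      by (auto simp: inner_diff_right)
    have "closure (interior S) \<subseteq> {y. a \<bullet> x \<le> a \<bullet> y}"
      using a(2) by (intro closure_minimal closed_halfspace_ge) auto
    then have "a \<bullet> x \<le> a \<bullet> y" if "y \<in> S" for y
      using that convex_closure_interior[OF assms(2) False] closure_subset by blast
    with a(1) show ?thesis by (intro exI[of _ "- a"]) auto
  qed
  then obtain a where "a \<noteq> 0" "a \<in> normal_cone S x"
    by (auto simp: normal_cone_def inner_diff_right)
  then show thesis
    using that[of "(1 / norm a) *\<^sub>R a"] scaled_normal_in_normal_cone[of a S x "1 / norm a"] by simp
qed

text \<open>
  The number \<open>d\<close> is the signed distance from \<open>y\<close> to the boundary, negative outside \<open>S\<close>. Treating
  both signs at once lets the argument for inscribed balls run without knowing beforehand on which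
  side of the boundary the center of the ball lies.
\<close>

lemma nearest_boundary_normal:
  fixes S :: "'a::euclidean_space set"
  assumes S: "closed S" "convex S" "S \<noteq> {}" and r: "r \<ge> 0" and y: "\<not> cball y r \<subseteq> S"
  obtains d \<zeta> where "y + d *\<^sub>R \<zeta> \<in> S" and "\<zeta> \<in> normal_cone S (y + d *\<^sub>R \<zeta>)" and "norm \<zeta> = 1"
    and "d < r" and "y \<in> S \<Longrightarrow> d \<ge> 0"
proof (cases "y \<in> S")
  case False
  define p where "p = closest_point S y"
  have p: "p \<in> S" using closest_point_in_set[OF S(1,3)] by (simp add: p_def)
  with False have n: "norm (y - p) > 0" by auto
  have "(y - p) \<in> normal_cone S p"
    using closest_point_dot[OF S(2,1)] by (simp add: normal_cone_def p_def)
  then have "(1 / norm (y - p)) *\<^sub>R (y - p) \<in> normal_cone S p"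
    by (rule scaled_normal_in_normal_cone) simp
  moreover have "y + (- norm (y - p)) *\<^sub>R ((1 / norm (y - p)) *\<^sub>R (y - p)) = p"
    using n by simp
  moreover have "- norm (y - p) < r" using n r by linarith
  moreover have "norm ((1 / norm (y - p)) *\<^sub>R (y - p)) = 1" using n by simp
  ultimately show thesis
    using p False that[of "- norm (y - p)" "(1 / norm (y - p)) *\<^sub>R (y - p)"] by metis
next
  case True
  define p where "p = closest_point (frontier S) y"
  have "S \<noteq> UNIV" using y by auto
  then have ne: "frontier S \<noteq> {}"
    using S(3) frontier_eq_empty by blast
  have pf: "p \<in> frontier S" unfolding p_def
    by (rule closest_point_in_set[OF frontier_closed ne])
  then have p: "p \<in> S" using frontier_subset_closed[OF S(1)] by blast
  obtain \<zeta> where \<zeta>: "\<zeta> \<in> normal_cone S p" "norm \<zeta> = 1"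
    using boundary_unit_normal[OF S(1,2) pf] .
  define d where "d = dist y p"
  \<comment> \<open>The ball up to the nearest boundary point is connected and misses the boundary.\<close>
  have inball: "ball y d \<subseteq> S"
  proof (rule ccontr)
    assume no: "\<not> ball y d \<subseteq> S"
    then have "ball y d \<inter> S \<noteq> {}"
      using True by (metis IntI ball_eq_empty centre_in_ball empty_iff empty_subsetI not_le)
    then have "ball y d \<inter> frontier S \<noteq> {}"
      using no by (intro connected_Int_frontier) auto
    then obtain z where "z \<in> frontier S" "dist y z < d" by auto
    then show False
      using closest_point_le[OF frontier_closed, of z S y] by (simp add: d_def p_def)
  qed
  have cb: "cball y d \<subseteq> S"
  proof (cases "d = 0")
    case True with \<open>y \<in> S\<close> show ?thesis by simp
  next
    case False
    then have "d > 0" by (simp add: d_def)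
    then show ?thesis using closure_minimal[OF inball S(1)] by simp
  qed
  then have "d < r" using y by (meson not_le order_trans subset_cball)
  have "y + d *\<^sub>R \<zeta> \<in> S"
    using \<zeta>(2) by (intro subsetD[OF cb]) (simp add: dist_norm d_def)
  then have "\<zeta> \<bullet> (y + d *\<^sub>R \<zeta> - p) \<le> 0" using \<zeta>(1) by (simp add: normal_cone_def)
  \<comment> \<open>Since \<open>norm (p - y) = d\<close>, this is the equality case of Cauchy-Schwarz: every unit normal
    at \<open>p\<close> points along the segment from \<open>y\<close>.\<close>
  then have "d \<le> \<zeta> \<bullet> (p - y)"
    using \<zeta>(2) by (simp add: inner_simps norm_eq_1)
  moreover have "(norm (p - y - d *\<^sub>R \<zeta>))\<^sup>2 = d\<^sup>2 - 2 * d * (\<zeta> \<bullet> (p - y)) + d\<^sup>2"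
  proof -
    have "(norm (p - y))\<^sup>2 = d\<^sup>2" by (simp add: d_def dist_norm norm_minus_commute)
    then show ?thesis using \<zeta>(2)
      by (simp add: norm_diff_sq power_mult_distrib inner_commute)
  qed
  moreover have "d \<ge> 0" by (simp add: d_def)
  ultimately have "(norm (p - y - d *\<^sub>R \<zeta>))\<^sup>2 \<le> 0"
    using mult_left_mono[of d "\<zeta> \<bullet> (p - y)" d] by (simp add: power2_eq_square)
  then have "p = y + d *\<^sub>R \<zeta>" by (simp add: algebra_simps)
  then show thesis using p \<zeta> \<open>d < r\<close> \<open>d \<ge> 0\<close> that[of d \<zeta>] by simp
qed

section \<open>Smooth sets are unions of balls of a fixed radius\<close>

text \<open>
  If the ball leaves \<open>S\<close>, its center has signed distance \<open>d < r\<close> to the boundary, attained at a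
  point with normal \<open>\<zeta>'\<close>. Put \<open>c = \<zeta> \<bullet> \<zeta>'\<close>. As \<open>x\<close> lies in the supporting half-space with normal
  \<open>\<zeta>'\<close>, \<open>r - d \<le> r (1 - c)\<close>, whereas smoothness between \<open>x\<close> and the nearest point amounts to
  \<open>2 r (1 - c) \<le> r - d\<close>. Together these contradict \<open>r - d > 0\<close>.
\<close>

lemma smooth_set_inscribed_ball:
  fixes S :: "'a::euclidean_space set"
  assumes S: "smooth_set \<beta> S" and \<beta>: "\<beta> > 0"
    and x: "x \<in> S" and \<zeta>: "\<zeta> \<in> normal_cone S x" "norm \<zeta> = 1"
  shows "cball (x - (1 / \<beta>) *\<^sub>R \<zeta>) (1 / \<beta>) \<subseteq> S"
proof (rule ccontr)
  define r where "r = 1 / \<beta>"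
  have r: "r > 0" "\<beta> = 1 / r" using \<beta> by (auto simp: r_def)
  assume "\<not> cball (x - (1 / \<beta>) *\<^sub>R \<zeta>) (1 / \<beta>) \<subseteq> S"
  then obtain d \<zeta>' where *: "x - r *\<^sub>R \<zeta> + d *\<^sub>R \<zeta>' \<in> S" "\<zeta>' \<in> normal_cone S (x - r *\<^sub>R \<zeta> + d *\<^sub>R \<zeta>')"
    "norm \<zeta>' = 1" "d < r"
    using nearest_boundary_normal[of S r "x - r *\<^sub>R \<zeta>"] S r unfolding smooth_set_def r_def[symmetric]
    by (metis less_imp_le)
  define c where "c = \<zeta> \<bullet> \<zeta>'"
  have "\<zeta>' \<bullet> (r *\<^sub>R \<zeta> - d *\<^sub>R \<zeta>') \<le> 0"
    using *(2) x by (auto simp: normal_cone_def algebra_simps)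
  then have 1: "r * c \<le> d"
    using *(3) by (simp add: inner_simps norm_eq_1 c_def inner_commute)
  have "norm (\<zeta> - \<zeta>') \<le> \<beta> * norm (x - (x - r *\<^sub>R \<zeta> + d *\<^sub>R \<zeta>'))"
    using S x \<zeta> * unfolding smooth_set_def by blast
  then have "r * norm (\<zeta> - \<zeta>') \<le> norm (r *\<^sub>R \<zeta> - d *\<^sub>R \<zeta>')"
    using r by (simp add: field_simps)
  then have "(r * norm (\<zeta> - \<zeta>'))\<^sup>2 \<le> (norm (r *\<^sub>R \<zeta> - d *\<^sub>R \<zeta>'))\<^sup>2"
    using r by (intro power_mono) auto
  then have "r\<^sup>2 * (2 - 2 * c) \<le> r\<^sup>2 + d\<^sup>2 - 2 * r * d * c"
    using \<zeta>(2) *(3) by (simp add: power_mult_distrib norm_diff_sq c_def mult.assoc mult.left_commute[of d r])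
  then have "(r - d) * (2 * r * (1 - c)) \<le> (r - d) * (r - d)"
    by (simp add: algebra_simps power2_eq_square)
  then have "2 * r * (1 - c) \<le> r - d"
    using *(4) by (simp add: mult_le_cancel_left)
  then show False using 1 *(4) by (simp add: algebra_simps)
qed

text \<open>
  A point at distance \<open>d < 1 / \<beta>\<close> from the boundary lies on the radius that joins the nearest
  boundary point to the center of the ball inscribed there, so it belongs to that ball. A point at distance
  at least \<open>1 / \<beta>\<close> is the center of its own ball.
\<close>

lemma smooth_set_covered_by_balls:
  fixes S :: "'a::euclidean_space set"
  assumes S: "smooth_set \<beta> S" and \<beta>: "\<beta> > 0" and y: "y \<in> S"
  obtains c where "cball c (1 / \<beta>) \<subseteq> S" and "y \<in> cball c (1 / \<beta>)"
proof (cases "cball y (1 / \<beta>) \<subseteq> S")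
  case True
  then show thesis using that[of y] \<beta> by simp
next
  case False
  then obtain d \<zeta> where *: "y + d *\<^sub>R \<zeta> \<in> S" "\<zeta> \<in> normal_cone S (y + d *\<^sub>R \<zeta>)" "norm \<zeta> = 1"
    "d < 1 / \<beta>" "d \<ge> 0"
    using nearest_boundary_normal[of S "1 / \<beta>" y] S \<beta> y unfolding smooth_set_def
    by (metis less_imp_le zero_less_divide_1_iff)
  have "y \<in> cball (y + d *\<^sub>R \<zeta> - (1 / \<beta>) *\<^sub>R \<zeta>) (1 / \<beta>)"
  proof -
    have "dist (y + d *\<^sub>R \<zeta> - (1 / \<beta>) *\<^sub>R \<zeta>) y = norm ((d - 1 / \<beta>) *\<^sub>R \<zeta>)"
      by (simp add: dist_norm algebra_simps)
    also have "\<dots> \<le> 1 / \<beta>" using * by simp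
    finally show ?thesis by simp
  qed
  with smooth_set_inscribed_ball[OF S \<beta> *(1,2,3)] show thesis using that by blast
qed

section \<open>Sums with a ball are smooth\<close>

text \<open>
  A linear functional is maximal over a sum only where it is maximal over both summands, and over
  the ball it is maximal at a single point.
\<close>

lemma normal_cone_plus_cball:
  fixes T :: "'a::real_inner set"
  assumes r: "r \<ge> 0" and t: "t \<in> T" and b: "norm b \<le> r" and \<zeta>: "\<zeta> \<in> normal_cone (T + cball 0 r) (t + b)"
    and n: "norm \<zeta> = 1"
  shows "b = r *\<^sub>R \<zeta>" and "\<zeta> \<in> normal_cone T t"
proof -
  have *: "\<zeta> \<bullet> (s + b' - (t + b)) \<le> 0" if "s \<in> T" "norm b' \<le> r" for s b'
    using \<zeta> that by (auto simp: normal_cone_def set_plus_intro)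
  from *[OF t, of "r *\<^sub>R \<zeta>"] have "r \<le> \<zeta> \<bullet> b"
    using r n by (simp add: inner_simps norm_eq_1)
  moreover have "(norm (b - r *\<^sub>R \<zeta>))\<^sup>2 = (norm b)\<^sup>2 - 2 * r * (\<zeta> \<bullet> b) + r\<^sup>2"
    using n by (simp add: norm_diff_sq power_mult_distrib inner_commute)
  moreover have "(norm b)\<^sup>2 \<le> r\<^sup>2" using b by (intro power_mono) auto
  moreover have "r * r \<le> r * (\<zeta> \<bullet> b)" using calculation(1) r by (rule mult_left_mono)
  ultimately have "(norm (b - r *\<^sub>R \<zeta>))\<^sup>2 \<le> 0"
    by (simp add: power2_eq_square)
  then show "b = r *\<^sub>R \<zeta>" by simp
  show "\<zeta> \<in> normal_cone T t"
    using *[OF _ b] by (auto simp: normal_cone_def algebra_simps)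
qed

text \<open>
  By the decomposition of normals, \<open>x - x' = (t - t') + r (\<zeta> - \<zeta>')\<close>, where \<open>\<zeta>\<close> and \<open>\<zeta>'\<close> are normals
  of \<open>T\<close> at \<open>t\<close> and \<open>t'\<close>. The two summands have nonnegative inner product because the normal cone
  is a monotone operator.
\<close>

lemma smooth_set_plus_cball:
  fixes T :: "'a::euclidean_space set"
  assumes T: "closed T" "convex T" "T \<noteq> {}" and \<beta>: "\<beta> > 0"
  shows "smooth_set \<beta> (T + cball 0 (1 / \<beta>))"
proof -
  define r where "r = 1 / \<beta>"
  have r: "r > 0" "\<beta> = 1 / r" using \<beta> by (auto simp: r_def)
  have eq: "T + cball 0 r = (\<Union>x\<in>T. \<Union>y\<in>cball 0 r. {x + y})"
    by (auto simp: set_plus_def)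
  have "norm (\<zeta> - \<zeta>') \<le> \<beta> * norm (x - x')"
    if x: "x \<in> T + cball 0 r" "x' \<in> T + cball 0 r"
      and \<zeta>: "\<zeta> \<in> normal_cone (T + cball 0 r) x" "\<zeta>' \<in> normal_cone (T + cball 0 r) x'"
        "norm \<zeta> = 1" "norm \<zeta>' = 1" for x x' \<zeta> \<zeta>'
  proof -
    obtain t b where t: "x = t + b" "t \<in> T" "norm b \<le> r" using x(1) by (auto elim!: set_plus_elim)
    obtain t' b' where t': "x' = t' + b'" "t' \<in> T" "norm b' \<le> r" using x(2) by (auto elim!: set_plus_elim)
    note 1 = normal_cone_plus_cball[OF less_imp_le[OF r(1)] t(2,3) \<zeta>(1)[unfolded t(1)] \<zeta>(3)]
    note 2 = normal_cone_plus_cball[OF less_imp_le[OF r(1)] t'(2,3) \<zeta>(2)[unfolded t'(1)] \<zeta>(4)]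
    have "\<zeta> \<bullet> (t' - t) \<le> 0" "\<zeta>' \<bullet> (t - t') \<le> 0"
      using 1(2) 2(2) t(2) t'(2) by (auto simp: normal_cone_def)
    then have mono: "(t - t') \<bullet> (\<zeta> - \<zeta>') \<ge> 0"
      by (simp add: inner_simps inner_commute)
    have "x - x' = (t - t') + r *\<^sub>R (\<zeta> - \<zeta>')"
      using t(1) t'(1) 1(1) 2(1) by (simp add: algebra_simps)
    then have "(norm (x - x'))\<^sup>2 = (norm (t - t'))\<^sup>2 + 2 * (r * ((t - t') \<bullet> (\<zeta> - \<zeta>'))) + (r * norm (\<zeta> - \<zeta>'))\<^sup>2"
      using r by (simp add: norm_add_sq power_mult_distrib)
    moreover have "r * ((t - t') \<bullet> (\<zeta> - \<zeta>')) \<ge> 0" using r mono by simp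
    ultimately have "(r * norm (\<zeta> - \<zeta>'))\<^sup>2 \<le> (norm (x - x'))\<^sup>2" by simp
    then have "r * norm (\<zeta> - \<zeta>') \<le> norm (x - x')" by (rule power2_le_imp_le) simp
    then show ?thesis by (simp add: r(2) pos_le_divide_eq[OF r(1)] mult.commute)
  qed
  moreover have "T + cball 0 r \<noteq> {}" using T(3) set_plus_intro[of _ T 0 "cball 0 r"] r by fastforce
  moreover have "closed (T + cball 0 r)" unfolding eq
    by (rule closed_compact_sums[OF T(1) compact_cball])
  moreover have "convex (T + cball 0 r)" using T(2) by (intro convex_set_plus) auto
  ultimately show ?thesis unfolding smooth_set_def r_def[symmetric] by blast
qed


section \<open>Balls inside a cone\<close>

lemma cball_subset_iff_add:
  fixes c :: "'a::real_normed_vector"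
  shows "cball c r \<subseteq> S \<longleftrightarrow> (\<forall>b. norm b \<le> r \<longrightarrow> c + b \<in> S)"
proof (intro iffI allI impI subsetI)
  fix b :: 'a assume "cball c r \<subseteq> S" "norm b \<le> r"
  moreover from this(2) have "c + b \<in> cball c r" by (simp add: dist_norm)
  ultimately show "c + b \<in> S" by blast
next
  fix x assume "\<forall>b. norm b \<le> r \<longrightarrow> c + b \<in> S" "x \<in> cball c r"
  moreover from this(2) have "norm (x - c) \<le> r" by (simp add: dist_norm norm_minus_commute)
  ultimately have "c + (x - c) \<in> S" by blast
  then show "x \<in> S" by simp
qed

lemma closed_convex_inner_parallel_set:
  fixes S :: "'a::real_normed_vector set"
  assumes "closed S" and "convex S"
  shows "closed {c. cball c r \<subseteq> S}" and "convex {c. cball c r \<subseteq> S}"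
proof -
  have "c + b \<in> S \<longleftrightarrow> c \<in> (\<lambda>x. x - b) ` S" for b c :: 'a
    by (force simp: image_iff algebra_simps)
  then have eq: "{c. cball c r \<subseteq> S} = (\<Inter>b\<in>{b. norm b \<le> r}. (\<lambda>x. x - b) ` S)"
    by (auto simp: cball_subset_iff_add)
  show "closed {c. cball c r \<subseteq> S}"
    unfolding eq using closed_translation_subtract[OF assms(1)] by (intro closed_INT) auto
  show "convex {c. cball c r \<subseteq> S}"
    unfolding eq using convex_translation_subtract[OF assms(2)] by (intro convex_INT) auto
qed

lemma cone_core_iff_cball: "x \<in> cone_core K \<longleftrightarrow> cball x 1 \<subseteq> K"
proof -
  have "{x} + cball 0 1 \<subseteq> K \<longleftrightarrow> (\<forall>b\<in>cball 0 1. x + b \<in> K)"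
    unfolding set_plus_def by blast
  then show ?thesis
    by (simp add: cone_core_def cball_subset_iff_add Ball_def)
qed

lemma cball_subset_cone_iff:
  assumes "convex_cone K" and "r > 0"
  shows "cball c r \<subseteq> K \<longleftrightarrow> (1 / r) *\<^sub>R c \<in> cone_core K"
proof -
  have K: "t *\<^sub>R x \<in> K" if "x \<in> K" "t \<ge> 0" for t x
    using convex_cone_scaleR[OF assms(1)] that by blast
  have "cball c r = (*\<^sub>R) r ` cball ((1 / r) *\<^sub>R c) 1"
    using assms(2) by (simp add: cball_scale)
  moreover have "r *\<^sub>R x \<in> K \<longleftrightarrow> x \<in> K" for x
    using K[of x r] K[of "r *\<^sub>R x" "1 / r"] assms(2) by auto
  then have "(*\<^sub>R) r ` A \<subseteq> K \<longleftrightarrow> A \<subseteq> K" for A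
    by (auto simp: image_subset_iff)
  ultimately show ?thesis by (simp add: cone_core_iff_cball)
qed

context
  fixes K :: "'a::euclidean_space set"
  assumes K: "convex_cone K" "closed K" "interior K \<noteq> {}" "K \<noteq> UNIV"
begin

lemma cone_center:
  shows cone_center_in_cone_core: "cone_center K \<in> cone_core K"
    and norm_cone_center_le: "x \<in> cone_core K \<Longrightarrow> norm (cone_center K) \<le> norm x"
    and cone_center_unique: "x \<in> cone_core K \<Longrightarrow> norm x \<le> norm (cone_center K) \<Longrightarrow> x = cone_center K"
proof -
  have ex1: "\<exists>!x. is_arg_min norm (\<lambda>x. x \<in> cone_core K) x"
    using cone_core_min_norm_unique[OF K(1-3)] .
  then have c: "is_arg_min norm (\<lambda>x. x \<in> cone_core K) (cone_center K)"
    unfolding cone_center_def arg_min_def by (metis someI)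
  then show "cone_center K \<in> cone_core K"
    and le: "x \<in> cone_core K \<Longrightarrow> norm (cone_center K) \<le> norm x" for x
    by (auto simp: is_arg_min_def not_less)
  show "x = cone_center K" if "x \<in> cone_core K" "norm x \<le> norm (cone_center K)" for x
  proof -
    have "is_arg_min norm (\<lambda>x. x \<in> cone_core K) x"
      using that le by (force simp: is_arg_min_def not_less)
    with c ex1 show ?thesis by blast
  qed
qed

text \<open>
  Otherwise the unit ball around the center contains the apex in its interior, and a cone that
  contains a neighbourhood of its apex is the whole space.
\<close>

lemma norm_cone_center_ge_1: "norm (cone_center K) \<ge> 1"
proof (rule ccontr)
  assume "\<not> ?thesis"
  then have e: "1 - norm (cone_center K) > 0" (is "?e > 0") by simp
  have sub: "cball 0 ?e \<subseteq> K"
  proof -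
    have "cball 0 ?e \<subseteq> cball (cone_center K) 1"
      using norm_triangle_ineq4[of "cone_center K"] by (force simp: dist_norm intro: order_trans)
    then show ?thesis using cone_center_in_cone_core by (auto simp: cone_core_iff_cball)
  qed
  have "x \<in> K" for x
  proof -
    define t where "t = ?e / (norm x + 1)"
    have pos: "norm x + 1 > 0" by (simp add: add_nonneg_pos)
    have "t > 0" using e pos by (simp add: t_def)
    moreover have "t * norm x \<le> t * (norm x + 1)" using \<open>t > 0\<close> by simp
    then have "t * norm x \<le> ?e" using pos by (simp add: t_def)
    ultimately have t: "t > 0" "norm (t *\<^sub>R x) \<le> ?e" by simp_all
    then have "t *\<^sub>R x \<in> K" using sub by auto
    then show ?thesis
      using t(1) convex_cone_scaleR[OF K(1), of "1 / t" "t *\<^sub>R x"] by simp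
  qed
  then show False using K(4) by blast
qed

text \<open>
  Both claims are the defining property of the center, rescaled. The second, uniqueness, is what
  makes the lower inclusion for optimal smoothings rigid.
\<close>

lemma cball_subset_cone_norm_ge:
  assumes "r > 0" and "cball c r \<subseteq> K"
  shows "r * norm (cone_center K) \<le> norm c"
    and "norm c \<le> r * norm (cone_center K) \<Longrightarrow> c = r *\<^sub>R cone_center K"
proof -
  have c: "(1 / r) *\<^sub>R c \<in> cone_core K"
    using assms cball_subset_cone_iff[OF K(1)] by blast
  show "r * norm (cone_center K) \<le> norm c"
    using norm_cone_center_le[OF c] assms(1) by (simp add: field_simps)
  show "c = r *\<^sub>R cone_center K" if "norm c \<le> r * norm (cone_center K)"
    proof -
    have "(1 / r) *\<^sub>R c = cone_center K"
      using that assms(1) by (intro cone_center_unique[OF c]) (simp add: field_simps)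
    then have "r *\<^sub>R ((1 / r) *\<^sub>R c) = r *\<^sub>R cone_center K" by simp
    then show ?thesis using assms(1) by simp
  qed
qed

section \<open>The extremal smoothings\<close>

lemma mem_scaled_max_inner_smoothing:
  assumes "r > 0"
  shows "x \<in> scaled_set r (max_inner_smoothing K) \<longleftrightarrow> (\<exists>c. cball c r \<subseteq> K \<and> x \<in> cball c r)"
proof
  assume "x \<in> scaled_set r (max_inner_smoothing K)"
  then obtain c b where *: "x = r *\<^sub>R (c + b)" "c \<in> cone_core K" "norm b \<le> 1"
    unfolding scaled_set_def max_inner_smoothing_def set_plus_def by fastforce
  then have "cball (r *\<^sub>R c) r \<subseteq> K" "x \<in> cball (r *\<^sub>R c) r"
    using assms cball_subset_cone_iff[OF K(1)]
    by (auto simp: dist_norm scaleR_add_right)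
  then show "\<exists>c. cball c r \<subseteq> K \<and> x \<in> cball c r" by blast
next
  assume "\<exists>c. cball c r \<subseteq> K \<and> x \<in> cball c r"
  then obtain c where c: "cball c r \<subseteq> K" "norm (x - c) \<le> r"
    by (auto simp: dist_norm norm_minus_commute)
  have "x = r *\<^sub>R ((1 / r) *\<^sub>R c + (1 / r) *\<^sub>R (x - c))"
    using assms by (simp add: algebra_simps)
  moreover have "(1 / r) *\<^sub>R c + (1 / r) *\<^sub>R (x - c) \<in> cone_core K + cball 0 1"
    using c assms cball_subset_cone_iff[OF K(1)] by (intro set_plus_intro) auto
  ultimately show "x \<in> scaled_set r (max_inner_smoothing K)"
    unfolding scaled_set_def max_inner_smoothing_def by (rule image_eqI)
qed

text \<open>
  Scaling leaves the cone itself fixed, so the scaled set is again a sum of a closed convex set and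
  a ball.
\<close>

lemma scaled_min_inner_smoothing:
  assumes "r > 0"
  shows "scaled_set r (min_inner_smoothing K) = (+) (r *\<^sub>R cone_center K) ` K + cball 0 r"
proof (intro equalityI subsetI)
  fix x assume "x \<in> scaled_set r (min_inner_smoothing K)"
  then obtain k b where *: "x = r *\<^sub>R (cone_center K + k + b)" "k \<in> K" "norm b \<le> 1"
    unfolding scaled_set_def min_inner_smoothing_def set_plus_def by fastforce
  have "x = (r *\<^sub>R cone_center K + r *\<^sub>R k) + r *\<^sub>R b"
    by (simp add: *(1) scaleR_add_right)
  moreover have "r *\<^sub>R k \<in> K" "norm (r *\<^sub>R b) \<le> r"
    using * assms convex_cone_scaleR[OF K(1)] by auto
  ultimately show "x \<in> (+) (r *\<^sub>R cone_center K) ` K + cball 0 r"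
    by (auto intro!: set_plus_intro)
next
  fix x assume "x \<in> (+) (r *\<^sub>R cone_center K) ` K + cball 0 r"
  then obtain k b where *: "x = r *\<^sub>R cone_center K + k + b" "k \<in> K" "norm b \<le> r"
    by (auto elim!: set_plus_elim)
  have "x = r *\<^sub>R (cone_center K + (1 / r) *\<^sub>R k + (1 / r) *\<^sub>R b)"
    using assms by (simp add: *(1) scaleR_add_right)
  moreover have "(1 / r) *\<^sub>R k \<in> K" "(1 / r) *\<^sub>R b \<in> cball 0 1"
    using * assms convex_cone_scaleR[OF K(1)] by auto
  ultimately show "x \<in> scaled_set r (min_inner_smoothing K)"
    unfolding scaled_set_def min_inner_smoothing_def by (intro image_eqI[of x] set_plus_intro) auto
qed

lemma smooth_scaled_min_inner_smoothing:
  assumes "\<beta> > 0"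
  shows "smooth_set \<beta> (scaled_set (1 / \<beta>) (min_inner_smoothing K))"
proof -
  have "K \<noteq> {}" "convex K" using K(1) by (auto simp: convex_cone_def)
  then show ?thesis
    using assms K(2) by (subst scaled_min_inner_smoothing)
      (auto intro!: smooth_set_plus_cball closed_translation convex_translation)
qed

lemma scaled_max_inner_smoothing_subset_cone:
  assumes "r > 0"
  shows "scaled_set r (max_inner_smoothing K) \<subseteq> K"
proof
  fix x assume "x \<in> scaled_set r (max_inner_smoothing K)"
  then show "x \<in> K"
    unfolding mem_scaled_max_inner_smoothing[OF assms] by blast
qed

lemma min_inner_smoothing_subset_max: "scaled_set r (min_inner_smoothing K) \<subseteq> scaled_set r (max_inner_smoothing K)"
proof -
  have "cone_center K + k \<in> cone_core K" if "k \<in> K" for k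
    using cone_center_in_cone_core convex_cone_add[OF K(1) _ that]
    unfolding cone_core_iff_cball cball_subset_iff_add by (metis add.assoc add.commute)
  then have "{cone_center K} + K \<subseteq> cone_core K"
    by (auto elim!: set_plus_elim)
  then show ?thesis
    unfolding scaled_set_def min_inner_smoothing_def max_inner_smoothing_def
    by (intro image_mono set_plus_mono2 order_refl)
qed

text \<open>
  The obstruction to approximating \<open>K\<close> sits at its apex: a point of \<open>S\<close> lies in a ball of radius
  \<open>1 / \<beta>\<close> inside \<open>K\<close>, whose center cannot be close to the origin.
\<close>

lemma smooth_subset_cone_infdist_0:
  assumes "smooth_set \<beta> S" and "S \<subseteq> K" and \<beta>: "\<beta> > 0"
  shows "cone_width K / \<beta> \<le> infdist 0 S"
proof -
  have "closed S" "S \<noteq> {}" using assms(1) by (auto simp: smooth_set_def)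
  then obtain s where s: "s \<in> S" "infdist 0 S = norm s"
    using infdist_attained[of S 0] by (metis dist_0_norm)
  obtain c where c: "cball c (1 / \<beta>) \<subseteq> S" "s \<in> cball c (1 / \<beta>)"
    using smooth_set_covered_by_balls[OF assms(1) \<beta> s(1)] .
  have "(1 / \<beta>) * norm (cone_center K) \<le> norm c"
    using cball_subset_cone_norm_ge(1)[of "1 / \<beta>" c] \<beta> c(1) assms(2) by auto
  also have "norm c \<le> norm s + 1 / \<beta>"
    using c(2) norm_triangle_sub[of c s] by (simp add: dist_norm)
  finally show ?thesis by (simp add: s(2) cone_width_def diff_divide_distrib)
qed

lemma infdist_scaled_min_inner_smoothing:
  assumes "r > 0" and "k \<in> K"
  shows "infdist k (scaled_set r (min_inner_smoothing K)) \<le> r * cone_width K"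
proof -
  let ?x = "cone_center K"
  \<comment> \<open>From the center \<open>r x + k\<close>, go the full radius towards \<open>k\<close>, that is, along \<open>- x\<close>.\<close>
  define b where "b = - (r / norm ?x) *\<^sub>R ?x"
  have n: "norm ?x \<ge> 1" by (rule norm_cone_center_ge_1)
  then have "norm b = r" using assms(1) by (auto simp: b_def)
  then have "r *\<^sub>R ?x + k + b \<in> scaled_set r (min_inner_smoothing K)"
    using assms by (subst scaled_min_inner_smoothing) auto
  then have "infdist k (scaled_set r (min_inner_smoothing K)) \<le> dist k (r *\<^sub>R ?x + k + b)"
    by (rule infdist_le)
  also have "dist k (r *\<^sub>R ?x + k + b) = norm (r *\<^sub>R ?x + b)"
    by (subst norm_minus_cancel[symmetric]) (simp add: dist_norm algebra_simps)
  also have "r *\<^sub>R ?x + b = (r * (1 - 1 / norm ?x)) *\<^sub>R ?x"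
    by (simp add: b_def algebra_simps)
  also have "norm \<dots> = r * (norm ?x - 1)"
  proof -
    have *: "\<bar>r * (1 - 1 / t)\<bar> * t = r * (t - 1)" if "t \<ge> 1" for t :: real
    proof -
      have "1 - 1 / t \<ge> 0" using that by simp
      then show ?thesis using that assms(1) by (simp add: abs_mult field_simps)
    qed
    show ?thesis unfolding norm_scaleR by (rule *[OF n])
  qed
  finally show ?thesis by (simp add: cone_width_def)
qed

text \<open>
  The argument takes place in the set \<open>C\<close> of centers of balls of radius \<open>r\<close> inside \<open>S\<close>, which
  inherits closedness and convexity from \<open>S\<close>. It contains the scaled center of \<open>K\<close>, and every
  direction of \<open>K\<close> is a recession direction of \<open>C\<close>.
\<close>

lemma near_smooth_set_contains_min_inner_smoothing:
  assumes S: "smooth_set \<beta> S" "S \<subseteq> K" and \<beta>: "\<beta> > 0"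
    and near: "\<And>k. k \<in> K \<Longrightarrow> infdist k S \<le> cone_width K / \<beta>"
  shows "scaled_set (1 / \<beta>) (min_inner_smoothing K) \<subseteq> S"
proof -
  define r where "r = 1 / \<beta>"
  have r: "r > 0" using \<beta> by (simp add: r_def)
  let ?x = "r *\<^sub>R cone_center K"
  define C where "C = {c. cball c r \<subseteq> S}"
  have Sc: "closed S" "convex S" "S \<noteq> {}" using S(1) by (auto simp: smooth_set_def)
  have C: "closed C" "convex C"
    unfolding C_def using closed_convex_inner_parallel_set[OF Sc(1,2)] by blast+
  have near_C: "\<exists>c\<in>C. norm (k - c) \<le> r * norm (cone_center K)" if "k \<in> K" for k
  proof -
    obtain s where s: "s \<in> S" "infdist k S = dist k s"
      using infdist_attained[OF Sc(1,3)] by metis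
    obtain c where c: "cball c r \<subseteq> S" "s \<in> cball c r"
      using smooth_set_covered_by_balls[OF S(1) \<beta> s(1)] unfolding r_def by metis
    have "norm (k - c) \<le> dist k s + dist c s"
      by (metis dist_commute dist_norm dist_triangle2)
    also have "\<dots> \<le> r * cone_width K + r"
      using near[OF that] s(2) c(2) by (simp add: r_def)
    finally show ?thesis using c(1) by (auto simp: C_def cone_width_def algebra_simps)
  qed
  have "0 \<in> K" by (rule convex_cone_contains_0[OF K(1)])
  from near_C[OF this] obtain c where "c \<in> C" "norm c \<le> r * norm (cone_center K)" by auto
  then have x: "?x \<in> C"
    using cball_subset_cone_norm_ge(2)[OF r, of c] S(2) by (auto simp: C_def)
  have "?x + k \<in> C" if k: "k \<in> K" for k
  proof -
    have "\<forall>n. \<exists>c\<in>C. norm (real (Suc n) *\<^sub>R k - c) \<le> r * norm (cone_center K)"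
      using near_C convex_cone_scaleR[OF K(1) _ k] by simp
    then obtain c where c: "\<And>n. c n \<in> C" "\<And>n. norm (real (Suc n) *\<^sub>R k - c n) \<le> r * norm (cone_center K)"
      by metis
    \<comment> \<open>The points \<open>c n\<close> stay within bounded distance of \<open>(n + 1) k\<close>. Moving from \<open>r x\<close> the fraction
      \<open>1 / (n + 1)\<close> of the way to \<open>c n\<close> stays in \<open>C\<close> and approaches \<open>r x + k\<close>.\<close>
    define z where "z n = (1 - inverse (real (Suc n))) *\<^sub>R ?x + inverse (real (Suc n)) *\<^sub>R c n" for n
    have z: "z n \<in> C" for n
      unfolding z_def using C(2) x c(1) by (intro convexD) (auto simp: field_simps)
    have bound: "norm (z n - (?x + k)) \<le> inverse (real (Suc n)) * (2 * (r * norm (cone_center K)))" for n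
    proof -
      have "z n - (?x + k) = inverse (real (Suc n)) *\<^sub>R ((c n - real (Suc n) *\<^sub>R k) - ?x)"
      proof -
        have "inverse (real (Suc n)) *\<^sub>R (real (Suc n) *\<^sub>R k) = k" by simp
        then show ?thesis
          by (simp only: z_def scaleR_diff_right scaleR_diff_left scaleR_one) (simp only: algebra_simps)
      qed
      also have "norm \<dots> = inverse (real (Suc n)) * norm ((c n - real (Suc n) *\<^sub>R k) - ?x)" by simp
      also have "norm ((c n - real (Suc n) *\<^sub>R k) - ?x) \<le> r * norm (cone_center K) + r * norm (cone_center K)"
        using c(2)[of n] r norm_triangle_ineq4[of "c n - real (Suc n) *\<^sub>R k" ?x]
        by (simp add: norm_minus_commute)
      finally show ?thesis by (simp add: mult_left_mono)
    qed
    have "(\<lambda>n. inverse (real (Suc n)) * (2 * (r * norm (cone_center K)))) \<longlonglongrightarrow> 0"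
      by (rule tendsto_mult_left_zero[OF LIMSEQ_inverse_real_of_nat])
    then have "(\<lambda>n. z n - (?x + k)) \<longlonglongrightarrow> 0"
      by (rule Lim_null_comparison[rotated]) (rule always_eventually[OF allI], rule bound)
    then have "z \<longlonglongrightarrow> ?x + k" by (rule LIM_zero_cancel)
    with C(1) z show ?thesis by (rule closed_sequentially)
  qed
  then have sub: "?x + k + b \<in> S" if "k \<in> K" "norm b \<le> r" for k b
    using that by (simp add: C_def cball_subset_iff_add)
  have "(+) ?x ` K + cball 0 r \<subseteq> S"
  proof
    fix x assume "x \<in> (+) ?x ` K + cball 0 r"
    then obtain k b where "x = ?x + k + b" "k \<in> K" "norm b \<le> r"
      by (auto elim!: set_plus_elim)
    then show "x \<in> S" using sub by simp
  qed
  then show ?thesis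
    unfolding r_def[symmetric] scaled_min_inner_smoothing[OF r] .
qed

end

section \<open>Hausdorff distance and optimality\<close>

lemma hausdorff_dist_subset_le_iff:
  assumes "S \<subseteq> K" and "S \<noteq> {}"
  shows "hausdorff_dist K S \<le> ereal v \<longleftrightarrow> (\<forall>k\<in>K. infdist k S \<le> v)"
proof -
  have "excess S K \<le> excess K S"
    unfolding excess_def
  proof (intro SUP_mono bexI)
    fix s assume "s \<in> S"
    then show "s \<in> K" "ereal (infdist s K) \<le> ereal (infdist s S)"
      using assms(1) by auto
  qed
  then show ?thesis by (auto simp: hausdorff_dist_def excess_def SUP_le_iff max.absorb1)
qed

lemma hausdorff_dist_commute: "hausdorff_dist A B = hausdorff_dist B A"
  by (simp add: hausdorff_dist_def max.commute)

theorem theorem4p4: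
  fixes K :: "'a::euclidean_space set"
  assumes "convex_cone K"
    and "closed K"
    and "interior K \<noteq> {}"
    and "K \<noteq> UNIV"
  shows "(\<forall>l::real. inner_smoothable l K \<longleftrightarrow> l \<ge> cone_width K) \<and>
    (\<forall>\<beta>>0. \<forall>S. smooth_set \<beta> S \<longrightarrow>
      (optimal_inner_smoothing \<beta> K S \<longleftrightarrow>
        scaled_set (1 / \<beta>) (min_inner_smoothing K) \<subseteq> S \<and>
        S \<subseteq> scaled_set (1 / \<beta>) (max_inner_smoothing K)))"
proof -
  note K = assms
  let ?w = "cone_width K"
  let ?min = "\<lambda>\<beta>. scaled_set (1 / \<beta>) (min_inner_smoothing K)"
  let ?max = "\<lambda>\<beta>. scaled_set (1 / \<beta>) (max_inner_smoothing K)"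
  have lower: "?w / \<beta> \<le> v"
    if "\<beta> > 0" "smooth_set \<beta> S" "S \<subseteq> K" "hausdorff_dist K S \<le> ereal v" for \<beta> S v
  proof -
    have "infdist 0 S \<le> v"
      using that convex_cone_contains_0[OF K(1)]
      by (subst (asm) hausdorff_dist_subset_le_iff) (auto simp: smooth_set_def)
    then show ?thesis using smooth_subset_cone_infdist_0[OF K that(2,3,1)] by simp
  qed
  have min: "smooth_set \<beta> (?min \<beta>)" "?min \<beta> \<subseteq> K" "?min \<beta> \<noteq> {}" if "\<beta> > 0" for \<beta>
  proof -
    show s: "smooth_set \<beta> (?min \<beta>)" by (rule smooth_scaled_min_inner_smoothing[OF K that])
    then show "?min \<beta> \<noteq> {}" by (simp add: smooth_set_def)
    show "?min \<beta> \<subseteq> K"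
      using min_inner_smoothing_subset_max[OF K] scaled_max_inner_smoothing_subset_cone[OF K] that
      by (meson order_trans zero_less_divide_1_iff)
  qed
  have upper: "hausdorff_dist K S \<le> ereal (?w / \<beta>)" if "\<beta> > 0" "?min \<beta> \<subseteq> S" "S \<subseteq> K" for \<beta> S
  proof -
    have "infdist k S \<le> ?w / \<beta>" if "k \<in> K" for k
      using infdist_mono[OF \<open>?min \<beta> \<subseteq> S\<close> min(3), of k] \<open>\<beta> > 0\<close>
        infdist_scaled_min_inner_smoothing[OF K _ that, of "1 / \<beta>"] by simp
    then show ?thesis using that min(3)[of \<beta>] by (subst hausdorff_dist_subset_le_iff) auto
  qed
  have "inner_smoothable l K \<longleftrightarrow> ?w \<le> l" for l
  proof
    assume "inner_smoothable l K"
    then obtain S where "smooth_set 1 S" "S \<subseteq> K" "hausdorff_dist K S \<le> ereal (l / 1)"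
      unfolding inner_smoothable_def by (metis hausdorff_dist_commute zero_less_one)
    from lower[OF zero_less_one this] show "?w \<le> l" by simp
  next
    assume l: "?w \<le> l"
    show "inner_smoothable l K" unfolding inner_smoothable_def
    proof (intro allI impI)
      fix \<beta> :: real assume \<beta>: "\<beta> > 0"
      have "hausdorff_dist (?min \<beta>) K \<le> ereal (?w / \<beta>)"
        using upper[OF \<beta> order_refl min(2)[OF \<beta>]] by (simp add: hausdorff_dist_commute)
      also have "\<dots> \<le> ereal (l / \<beta>)" using l \<beta> by (simp add: divide_right_mono)
      finally show "\<exists>S. smooth_set \<beta> S \<and> S \<subseteq> K \<and> hausdorff_dist S K \<le> ereal (l / \<beta>)"
        using min[OF \<beta>] by blast
    qed
  qed
  moreover have "optimal_inner_smoothing \<beta> K S \<longleftrightarrow> ?min \<beta> \<subseteq> S \<and> S \<subseteq> ?max \<beta>"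
    if \<beta>: "\<beta> > 0" and S: "smooth_set \<beta> S" for \<beta> S
  proof
    assume opt: "optimal_inner_smoothing \<beta> K S"
    then have SK: "S \<subseteq> K" by (simp add: optimal_inner_smoothing_def)
    have "hausdorff_dist K S \<le> hausdorff_dist K (?min \<beta>)"
      using opt min[OF \<beta>] by (simp add: optimal_inner_smoothing_def)
    also have "\<dots> \<le> ereal (?w / \<beta>)" using upper[OF \<beta> order_refl min(2)[OF \<beta>]] .
    finally have "\<forall>k\<in>K. infdist k S \<le> ?w / \<beta>"
      using SK S by (subst (asm) hausdorff_dist_subset_le_iff) (auto simp: smooth_set_def)
    then have "?min \<beta> \<subseteq> S"
      using near_smooth_set_contains_min_inner_smoothing[OF K S SK \<beta>] by blast
    moreover have "S \<subseteq> ?max \<beta>"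
    proof
      fix s assume "s \<in> S"
      then obtain c where "cball c (1 / \<beta>) \<subseteq> S" "s \<in> cball c (1 / \<beta>)"
        using smooth_set_covered_by_balls[OF S \<beta>] by metis
      then show "s \<in> ?max \<beta>"
        using mem_scaled_max_inner_smoothing[OF K, of "1 / \<beta>" s] SK \<beta> by auto
    qed
    ultimately show "?min \<beta> \<subseteq> S \<and> S \<subseteq> ?max \<beta>" ..
  next
    assume *: "?min \<beta> \<subseteq> S \<and> S \<subseteq> ?max \<beta>"
    then have SK: "S \<subseteq> K"
      using scaled_max_inner_smoothing_subset_cone[OF K, of "1 / \<beta>"] \<beta> by auto
    have "hausdorff_dist K S \<le> hausdorff_dist K S'" if S': "smooth_set \<beta> S'" "S' \<subseteq> K" for S'
    proof -
      have "ereal (?w / \<beta>) \<le> hausdorff_dist K S'"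
      \<comment> \<open>The distance may be infinite, so the bound is tested against finite upper bounds.\<close>
      proof (rule ereal_le_real)
        fix v assume "hausdorff_dist K S' \<le> ereal v"
        then show "ereal (?w / \<beta>) \<le> ereal v" using lower[OF \<beta> S'] by simp
      qed
      with upper[OF \<beta> _ SK] * show ?thesis by (meson order_trans)
    qed
    with S SK show "optimal_inner_smoothing \<beta> K S" by (simp add: optimal_inner_smoothing_def)
  qed
  ultimately show ?thesis by blast
qed

end
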